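(* Assume that, for each $n\in\mathbb{N}_0$, the real stochastic processes $\{V_{n1}(\varphi),\varphi\in[0,\pi]\}$ and $\{V_{n2}(\varphi),\varphi\in[0,\pi]\}$ have mean $0$ and covariance function $b_n(\varphi_1,\varphi_2)$, and that all the processes $\{V_{n1}(\varphi),\varphi\in[0,\pi]\}$ and $\{V_{n2}(\varphi),\varphi\in[0,\pi]\}$, $n\in\mathbb{N}_0$, are independent. If $\sum_{n=0}^\infty b_n(\varphi_1,\varphi_2)$ converges, then $$Z(\varphi,\theta)=\sum_{n=0}^\infty\left(V_{n1}(\varphi)\cos(n\theta)+V_{n2}(\varphi)\sin(n\theta)\right),\qquad \varphi\in[0,\pi],\ \theta\in[0,2\pi],$$ is a longitudinally reversible random field on $\mathbb{S}^2$ with mean $0$ and covariance function $$C(\varphi_1,\varphi_2,\theta)=\sum_{n=0}^\infty b_n(\varphi_1,\varphi_2)\cos(n\theta),\qquad \varphi_1,\varphi_2\in[0,\pi],\ \theta\in[-2\pi,2\pi].$$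
   Context: $\mathbb{N}_0$ is the set of nonnegative integers. $\mathbb{S}^2$ is the unit sphere in $\mathbb{R}^3$; a point of $\mathbb{S}^2$ with longitude $\theta\in[0,2\pi]$ and latitude $\varphi\in[0,\pi]$ is designated $\mathbf{x}=(\varphi,\theta)$, and a random field on $\mathbb{S}^2$ is written in these coordinates as $\{Z(\varphi,\theta),\varphi\in[0,\pi],\theta\in[0,2\pi]\}$. A real second-order random field on $\mathbb{S}^2$ is axially symmetric if its mean depends only on $\varphi$ and $\mathrm{cov}(Z(\varphi_1,\theta_1),Z(\varphi_2,\theta_2))$ depends only on $\varphi_1,\varphi_2,\theta_1-\theta_2$; this covariance is then written $C(\varphi_1,\varphi_2,\theta_1-\theta_2)$. The field (or its covariance function) is longitudinally reversible if moreover $C(\varphi_1,\varphi_2,-\theta)=C(\varphi_1,\varphi_2,\theta)$ for all $\varphi_1,\varphi_2\in[0,\pi]$, $\theta\in[-2\pi,2\pi]$. Convergence of $\sum_n b_n(\varphi_1,\varphi_2)$ is for all $\varphi_1,\varphi_2\in[0,\pi]$; the random series defining $Z$ is understood in the mean square sense.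
   Formalization: The random field on the sphere is read as a family in the coordinates (latitude, longitude), identified almost surely at longitudes 0 and 2π; consistency at the two poles is not claimed, since it fails, e.g., for b_1 constantly 1 and all other b_n zero. *)

theory Defs
  imports "HOL-Probability.Probability"
begin

definition second_order :: "'a measure \<Rightarrow> ('a \<Rightarrow> real) \<Rightarrow> bool" where
  "second_order M X \<longleftrightarrow> X \<in> borel_measurable M \<and> integrable M (\<lambda>\<omega>. (X \<omega>)\<^sup>2)"

definition mean :: "'a measure \<Rightarrow> ('a \<Rightarrow> real) \<Rightarrow> real" where
  "mean M X = (LINT \<omega>|M. X \<omega>)"

definition covariance :: "'a measure \<Rightarrow> ('a \<Rightarrow> real) \<Rightarrow> ('a \<Rightarrow> real) \<Rightarrow> real" where
  "covariance M X Y = (LINT \<omega>|M. (X \<omega> - mean M X) * (Y \<omega> - mean M Y))"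

text \<open>The membership conditions are essential: the Bochner integral of a non-integrable function
  is 0, so the limit alone would not express mean square convergence.\<close>

definition mean_square_sums ::
  "'a measure \<Rightarrow> (nat \<Rightarrow> 'a \<Rightarrow> real) \<Rightarrow> ('a \<Rightarrow> real) \<Rightarrow> bool" where
  "mean_square_sums M X S \<longleftrightarrow>
     (\<forall>n. second_order M (X n)) \<and> second_order M S \<and>
     (\<lambda>N. LINT \<omega>|M. ((\<Sum>n<N. X n \<omega>) - S \<omega>)\<^sup>2) \<longlonglongrightarrow> 0"

text \<open>Fields are written in coordinates: \<open>Z \<phi> \<theta>\<close> is the value at latitude \<open>\<phi> \<in> [0, \<pi>]\<close>
  and longitude \<open>\<theta> \<in> [0, 2\<pi>]\<close>. Longitudes 0 and \<open>2\<pi>\<close> name the same point, so the two values have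
  to agree, almost surely because mean square limits are determined only up to null sets.
  No condition is imposed at the poles \<open>\<phi> = 0, \<pi>\<close>, where the coordinates degenerate.\<close>

definition second_order_field :: "'a measure \<Rightarrow> (real \<Rightarrow> real \<Rightarrow> 'a \<Rightarrow> real) \<Rightarrow> bool" where
  "second_order_field M Z \<longleftrightarrow>
     (\<forall>\<phi>\<in>{0..pi}. \<forall>\<theta>\<in>{0..2*pi}. second_order M (Z \<phi> \<theta>)) \<and>
     (\<forall>\<phi>\<in>{0..pi}. AE \<omega> in M. Z \<phi> 0 \<omega> = Z \<phi> (2*pi) \<omega>)"

text \<open>Every element of \<open>[-2\<pi>, 2\<pi>]\<close> is a difference of two longitudes, so the values of \<open>C\<close> on
  \<open>[0, \<pi>] \<times> [0, \<pi>] \<times> [-2\<pi>, 2\<pi>]\<close> are determined by \<open>Z\<close>; outside that set \<open>C\<close> is irrelevant.\<close>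

definition has_axial_covariance ::
  "'a measure \<Rightarrow> (real \<Rightarrow> real \<Rightarrow> 'a \<Rightarrow> real) \<Rightarrow> (real \<Rightarrow> real \<Rightarrow> real \<Rightarrow> real) \<Rightarrow> bool" where
  "has_axial_covariance M Z C \<longleftrightarrow>
     (\<forall>\<phi>1\<in>{0..pi}. \<forall>\<phi>2\<in>{0..pi}. \<forall>\<theta>1\<in>{0..2*pi}. \<forall>\<theta>2\<in>{0..2*pi}.
        covariance M (Z \<phi>1 \<theta>1) (Z \<phi>2 \<theta>2) = C \<phi>1 \<phi>2 (\<theta>1 - \<theta>2))"

definition axially_symmetric :: "'a measure \<Rightarrow> (real \<Rightarrow> real \<Rightarrow> 'a \<Rightarrow> real) \<Rightarrow> bool" where
  "axially_symmetric M Z \<longleftrightarrow>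
     second_order_field M Z \<and>
     (\<exists>\<mu>. \<forall>\<phi>\<in>{0..pi}. \<forall>\<theta>\<in>{0..2*pi}. mean M (Z \<phi> \<theta>) = \<mu> \<phi>) \<and>
     (\<exists>C. has_axial_covariance M Z C)"

definition reversible_covariance :: "(real \<Rightarrow> real \<Rightarrow> real \<Rightarrow> real) \<Rightarrow> bool" where
  "reversible_covariance C \<longleftrightarrow>
     (\<forall>\<phi>1\<in>{0..pi}. \<forall>\<phi>2\<in>{0..pi}. \<forall>\<theta>\<in>{-2*pi..2*pi}. C \<phi>1 \<phi>2 (- \<theta>) = C \<phi>1 \<phi>2 \<theta>)"

definition longitudinally_reversible ::
  "'a measure \<Rightarrow> (real \<Rightarrow> real \<Rightarrow> 'a \<Rightarrow> real) \<Rightarrow> bool" where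
  "longitudinally_reversible M Z \<longleftrightarrow>
     axially_symmetric M Z \<and> (\<exists>C. has_axial_covariance M Z C \<and> reversible_covariance C)"

definition is_spectral_sum ::
  "'a measure \<Rightarrow> (nat \<Rightarrow> nat \<Rightarrow> real \<Rightarrow> 'a \<Rightarrow> real) \<Rightarrow> (real \<Rightarrow> real \<Rightarrow> 'a \<Rightarrow> real) \<Rightarrow> bool" where
  "is_spectral_sum M V Z \<longleftrightarrow>
     (\<forall>\<phi>\<in>{0..pi}. \<forall>\<theta>\<in>{0..2*pi}.
        mean_square_sums M
          (\<lambda>n \<omega>. V n 1 \<phi> \<omega> * cos (real n * \<theta>) + V n 2 \<phi> \<omega> * sin (real n * \<theta>)) (Z \<phi> \<theta>))"

text \<open>Independence of processes: each process is a random element of \<open>\<real>\<close> to the power \<open>[0, \<pi>]\<close> with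
  the product \<open>\<sigma>\<close>-algebra. Nothing is assumed about the dependence between different latitudes
  within one process.\<close>

definition independent_processes ::
  "'a measure \<Rightarrow> (nat \<Rightarrow> nat \<Rightarrow> real \<Rightarrow> 'a \<Rightarrow> real) \<Rightarrow> bool" where
  "independent_processes M V \<longleftrightarrow>
     prob_space.indep_vars M (\<lambda>_. PiM {0..pi} (\<lambda>_. borel))
       (\<lambda>(n, j) \<omega>. \<lambda>\<phi>\<in>{0..pi}. V n j \<phi> \<omega>) (UNIV \<times> {1, 2})"

end

theory Submission
  imports Defs
begin

text \<open>By independence the terms of the random series at a point are pairwise orthogonal in \<open>L\<^sup>2\<close>,
  with \<open>E (X\<^sub>n\<^sup>2) = b\<^sub>n(\<phi>, \<phi>)\<close> because \<open>cos\<^sup>2 + sin\<^sup>2 = 1\<close>, so the partial sums are Cauchy and converge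
  by completeness of \<open>L\<^sup>2\<close>. Continuity of the inner product then allows taking the mean and the
  covariance termwise, and the addition theorem for \<open>cos\<close> gives dependence on \<open>\<theta>\<^sub>1 - \<theta>\<^sub>2\<close> only.\<close>

section \<open>Mean square calculus\<close>

lemma second_order_measurable: "second_order M X \<Longrightarrow> X \<in> borel_measurable M"
  by (simp add: second_order_def)

text \<open>The product is dominated by the sum of the squares. Every later expansion of an integral
  rests on this, because the Bochner integral is additive only on integrable functions.\<close>

lemma second_order_integrable_mult:
  assumes "second_order M X" "second_order M Y"
  shows "integrable M (\<lambda>\<omega>. X \<omega> * Y \<omega>)"
proof (rule Bochner_Integration.integrable_bound)
  show "integrable M (\<lambda>\<omega>. (X \<omega>)\<^sup>2 + (Y \<omega>)\<^sup>2)"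
    using assms by (simp add: second_order_def)
  show "(\<lambda>\<omega>. X \<omega> * Y \<omega>) \<in> borel_measurable M"
    using assms by (auto simp: second_order_def)
  have "\<bar>x * y\<bar> \<le> x\<^sup>2 + y\<^sup>2" for x y :: real
  proof -
    have "0 \<le> (\<bar>x\<bar> - \<bar>y\<bar>)\<^sup>2" and nn: "0 \<le> \<bar>x\<bar> * \<bar>y\<bar>" by simp_all
    then have "2 * (\<bar>x\<bar> * \<bar>y\<bar>) \<le> x\<^sup>2 + y\<^sup>2"
      unfolding power2_diff by simp
    with nn have "\<bar>x\<bar> * \<bar>y\<bar> \<le> x\<^sup>2 + y\<^sup>2" by linarith
    then show ?thesis by (simp add: abs_mult)
  qed
  then show "AE \<omega> in M. norm (X \<omega> * Y \<omega>) \<le> norm ((X \<omega>)\<^sup>2 + (Y \<omega>)\<^sup>2)"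
    by (simp add: order_trans[OF _ abs_ge_self])
qed

lemma second_order_add:
  assumes "second_order M X" "second_order M Y"
  shows "second_order M (\<lambda>\<omega>. X \<omega> + Y \<omega>)"
  using assms second_order_integrable_mult[OF assms]
  by (auto simp: second_order_def power2_sum mult.assoc)

lemma second_order_cmult:
  "second_order M X \<Longrightarrow> second_order M (\<lambda>\<omega>. X \<omega> * c)" for c :: real
  by (auto simp: second_order_def power_mult_distrib)

lemma second_order_diff:
  assumes "second_order M X" "second_order M Y"
  shows "second_order M (\<lambda>\<omega>. X \<omega> - Y \<omega>)"
  using second_order_add[OF assms(1) second_order_cmult[OF assms(2), of "-1"]] by simp

lemma second_order_sum:
  "(\<And>i. i \<in> I \<Longrightarrow> second_order M (X i)) \<Longrightarrow> second_order M (\<lambda>\<omega>. \<Sum>i\<in>I. X i \<omega>)"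
proof (induction I rule: infinite_finite_induct)
  case (insert i I)
  then show ?case using second_order_add[of M "X i" "\<lambda>\<omega>. \<Sum>i\<in>I. X i \<omega>"] by simp
qed (simp_all add: second_order_def)

text \<open>Follows from expanding the nonnegative integral of
  \<open>(B * X - c * Y)\<^sup>2\<close>. Scaling by \<open>B\<close> instead of dividing by it
  keeps the expansion valid for \<open>B = 0\<close>; in that case \<open>Y\<close> vanishes almost
  everywhere, hence \<open>c = 0\<close>.\<close>

lemma Cauchy_Schwarz_second_order:
  assumes X: "second_order M X" and Y: "second_order M Y"
  shows "(LINT \<omega>|M. X \<omega> * Y \<omega>)\<^sup>2 \<le> (LINT \<omega>|M. (X \<omega>)\<^sup>2) * (LINT \<omega>|M. (Y \<omega>)\<^sup>2)"
proof -
  define A B c where "A = (LINT \<omega>|M. (X \<omega>)\<^sup>2)" and "B = (LINT \<omega>|M. (Y \<omega>)\<^sup>2)"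
    and "c = (LINT \<omega>|M. X \<omega> * Y \<omega>)"
  have int: "integrable M (\<lambda>\<omega>. (X \<omega>)\<^sup>2)" "integrable M (\<lambda>\<omega>. (Y \<omega>)\<^sup>2)"
    "integrable M (\<lambda>\<omega>. X \<omega> * Y \<omega>)"
    using X Y second_order_integrable_mult[OF X Y] by (auto simp: second_order_def)
  have B0: "B \<ge> 0" by (simp add: B_def)
  have "0 \<le> (LINT \<omega>|M. (B * X \<omega> - c * Y \<omega>)\<^sup>2)" by simp
  also have "\<dots> = (LINT \<omega>|M. B\<^sup>2 * (X \<omega>)\<^sup>2 + c\<^sup>2 * (Y \<omega>)\<^sup>2 - 2 * B * c * (X \<omega> * Y \<omega>))"
    by (rule Bochner_Integration.integral_cong) (auto simp: power2_eq_square algebra_simps)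
  also have "\<dots> = B\<^sup>2 * A + c\<^sup>2 * B - 2 * B * c * c"
    using int by (simp add: A_def B_def c_def)
  also have "\<dots> = B * (A * B - c\<^sup>2)"
    by (simp add: power2_eq_square algebra_simps)
  finally have *: "0 \<le> B * (A * B - c\<^sup>2)" .
  have "c\<^sup>2 \<le> A * B"
  proof (cases "B = 0")
    case True
    then have "AE \<omega> in M. (Y \<omega>)\<^sup>2 = 0"
      using int(2) by (simp add: B_def integral_nonneg_eq_0_iff_AE)
    then have "AE \<omega> in M. X \<omega> * Y \<omega> = 0" by auto
    then have "c = 0" unfolding c_def by (rule integral_eq_zero_AE)
    then show ?thesis using True by simp
  next
    case False
    then show ?thesis using * B0 by (simp add: zero_le_mult_iff)
  qed
  then show ?thesis by (simp add: A_def B_def c_def)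
qed

text \<open>By Cauchy-Schwarz the squared integral is at most a product tending to
  \<open>0 * c\<close>. Convergence of the second moments of \<open>Y\<close> is all that is asked
  of it, so both a fixed function and a second null sequence fit.\<close>

lemma tendsto_integral_mult_zero:
  assumes X: "\<And>n. second_order M (X n)" and Y: "\<And>n. second_order M (Y n)"
    and lX: "(\<lambda>n. LINT \<omega>|M. (X n \<omega>)\<^sup>2) \<longlonglongrightarrow> 0" and lY: "(\<lambda>n. LINT \<omega>|M. (Y n \<omega>)\<^sup>2) \<longlonglongrightarrow> c"
  shows "(\<lambda>n. LINT \<omega>|M. X n \<omega> * Y n \<omega>) \<longlonglongrightarrow> 0"
proof -
  have "(\<lambda>n. (LINT \<omega>|M. X n \<omega> * Y n \<omega>)\<^sup>2) \<longlonglongrightarrow> 0"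
  proof (rule tendsto_sandwich[OF _ _ tendsto_const])
    show "(\<lambda>n. (LINT \<omega>|M. (X n \<omega>)\<^sup>2) * (LINT \<omega>|M. (Y n \<omega>)\<^sup>2)) \<longlonglongrightarrow> 0"
      using tendsto_mult[OF lX lY] by simp
  qed (auto intro!: always_eventually Cauchy_Schwarz_second_order X Y)
  then have "(\<lambda>n. sqrt ((LINT \<omega>|M. X n \<omega> * Y n \<omega>)\<^sup>2)) \<longlonglongrightarrow> sqrt 0"
    by (rule tendsto_real_sqrt)
  then show ?thesis by (simp add: tendsto_rabs_zero_iff)
qed

text \<open>Continuity of the inner product: writing \<open>X n\<close> as \<open>S\<close> plus an
  error and \<open>Y n\<close> as \<open>T\<close> plus an error gives four products, and the three
  that contain an error tend to 0.\<close>

lemma tendsto_integral_mult: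
  assumes XN: "\<And>n. second_order M (X n)" and YN: "\<And>n. second_order M (Y n)"
    and S: "second_order M S" and T: "second_order M T"
    and lX: "(\<lambda>n. LINT \<omega>|M. (X n \<omega> - S \<omega>)\<^sup>2) \<longlonglongrightarrow> 0"
    and lY: "(\<lambda>n. LINT \<omega>|M. (Y n \<omega> - T \<omega>)\<^sup>2) \<longlonglongrightarrow> 0"
  shows "(\<lambda>n. LINT \<omega>|M. X n \<omega> * Y n \<omega>) \<longlonglongrightarrow> (LINT \<omega>|M. S \<omega> * T \<omega>)"
proof -
  note d = second_order_diff[OF XN S] second_order_diff[OF YN T]
  have "(LINT \<omega>|M. X n \<omega> * Y n \<omega>) =
      (LINT \<omega>|M. (X n \<omega> - S \<omega>) * (Y n \<omega> - T \<omega>)) + (LINT \<omega>|M. (X n \<omega> - S \<omega>) * T \<omega>) +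
      (LINT \<omega>|M. (Y n \<omega> - T \<omega>) * S \<omega>) + (LINT \<omega>|M. S \<omega> * T \<omega>)" (is "_ = ?r n") for n
  proof -
    have "(LINT \<omega>|M. X n \<omega> * Y n \<omega>) = (LINT \<omega>|M. (X n \<omega> - S \<omega>) * (Y n \<omega> - T \<omega>) +
        (X n \<omega> - S \<omega>) * T \<omega> + (Y n \<omega> - T \<omega>) * S \<omega> + S \<omega> * T \<omega>)"
      by (rule Bochner_Integration.integral_cong) (auto simp: algebra_simps)
    also have "\<dots> = ?r n"
      using second_order_integrable_mult[OF d, of n n] second_order_integrable_mult[OF d(1) T, of n]
        second_order_integrable_mult[OF d(2) S, of n] second_order_integrable_mult[OF S T]
      by simp
    finally show ?thesis .
  qed
  moreover have "?r \<longlonglongrightarrow> 0 + 0 + 0 + (LINT \<omega>|M. S \<omega> * T \<omega>)"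
    by (intro tendsto_add tendsto_const tendsto_integral_mult_zero[OF d lX lY]
        tendsto_integral_mult_zero[OF d(1) T lX tendsto_const]
        tendsto_integral_mult_zero[OF d(2) S lY tendsto_const])
  ultimately show ?thesis by simp
qed

lemma mean_square_limit_unique:
  assumes X: "\<And>n. second_order M (X n)" and S: "second_order M S" and T: "second_order M T"
    and lS: "(\<lambda>n. LINT \<omega>|M. (X n \<omega> - S \<omega>)\<^sup>2) \<longlonglongrightarrow> 0"
    and lT: "(\<lambda>n. LINT \<omega>|M. (X n \<omega> - T \<omega>)\<^sup>2) \<longlonglongrightarrow> 0"
  shows "AE \<omega> in M. S \<omega> = T \<omega>"
proof -
  note d = second_order_diff[OF X S] second_order_diff[OF X T] second_order_diff[OF S T]
  have "(LINT \<omega>|M. (S \<omega> - T \<omega>)\<^sup>2) \<le>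
      2 * (LINT \<omega>|M. (X n \<omega> - S \<omega>)\<^sup>2) + 2 * (LINT \<omega>|M. (X n \<omega> - T \<omega>)\<^sup>2)" for n
  proof -
    have "(s - t)\<^sup>2 \<le> 2 * (x - s)\<^sup>2 + 2 * (x - t)\<^sup>2" for x s t :: real
    proof -
      \<comment> \<open>Parallelogram law for \<open>x - s\<close> and \<open>x - t\<close>.\<close>
      have "2 * (x - s)\<^sup>2 + 2 * (x - t)\<^sup>2 - (s - t)\<^sup>2 = (2 * x - s - t)\<^sup>2"
        by (simp add: power2_eq_square algebra_simps)
      then show ?thesis by (metis diff_ge_0_iff_ge zero_le_power2)
    qed
    then have "(LINT \<omega>|M. (S \<omega> - T \<omega>)\<^sup>2) \<le>
        (LINT \<omega>|M. 2 * (X n \<omega> - S \<omega>)\<^sup>2 + 2 * (X n \<omega> - T \<omega>)\<^sup>2)"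
      using d by (intro integral_mono) (auto simp: second_order_def)
    also have "\<dots> = 2 * (LINT \<omega>|M. (X n \<omega> - S \<omega>)\<^sup>2) + 2 * (LINT \<omega>|M. (X n \<omega> - T \<omega>)\<^sup>2)"
      using d by (simp add: second_order_def)
    finally show ?thesis .
  qed
  moreover have "(\<lambda>n. 2 * (LINT \<omega>|M. (X n \<omega> - S \<omega>)\<^sup>2) + 2 * (LINT \<omega>|M. (X n \<omega> - T \<omega>)\<^sup>2))
      \<longlonglongrightarrow> 2 * 0 + 2 * 0"
    by (intro tendsto_intros lS lT)
  ultimately have "(LINT \<omega>|M. (S \<omega> - T \<omega>)\<^sup>2) \<le> 0"
    by (intro LIMSEQ_le_const) auto
  then have "(LINT \<omega>|M. (S \<omega> - T \<omega>)\<^sup>2) = 0"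
    by (simp add: order_antisym)
  then have "AE \<omega> in M. (S \<omega> - T \<omega>)\<^sup>2 = 0"
    using d(3) by (simp add: second_order_def integral_nonneg_eq_0_iff_AE)
  then show ?thesis by auto
qed

text \<open>Two families are allowed so that the identity covers both squared norms of partial sums
  (\<open>Y = X\<close>) and mixed moments of the series at two points of the sphere.\<close>

lemma integral_sum_mult_sum_orthogonal:
  assumes "finite I" and X: "\<And>i. i \<in> I \<Longrightarrow> second_order M (X i)"
    and Y: "\<And>i. i \<in> I \<Longrightarrow> second_order M (Y i)"
    and "\<And>i j. i \<in> I \<Longrightarrow> j \<in> I \<Longrightarrow> i \<noteq> j \<Longrightarrow> (LINT \<omega>|M. X i \<omega> * Y j \<omega>) = 0"
  shows "(LINT \<omega>|M. (\<Sum>i\<in>I. X i \<omega>) * (\<Sum>j\<in>I. Y j \<omega>)) = (\<Sum>i\<in>I. LINT \<omega>|M. X i \<omega> * Y i \<omega>)"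
proof -
  have "(LINT \<omega>|M. (\<Sum>i\<in>I. X i \<omega>) * (\<Sum>j\<in>I. Y j \<omega>)) = (\<Sum>i\<in>I. \<Sum>j\<in>I. LINT \<omega>|M. X i \<omega> * Y j \<omega>)"
    using second_order_integrable_mult[OF X Y]
    by (simp add: sum_product)
  also have "\<dots> = (\<Sum>i\<in>I. \<Sum>j\<in>I. if i = j then LINT \<omega>|M. X i \<omega> * Y i \<omega> else 0)"
    by (intro sum.cong) (auto simp: assms(4))
  finally show ?thesis using \<open>finite I\<close> by simp
qed

section \<open>Completeness, orthogonal series and uncorrelated processes\<close>

context prob_space
begin

lemma second_order_const: "second_order M (\<lambda>_. c)" for c :: real
  by (simp add: second_order_def)

lemma second_order_integrable: "second_order M X \<Longrightarrow> integrable M X"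
  using second_order_integrable_mult[OF _ second_order_const[of 1]] by simp

text \<open>Completeness of \<open>L\<^sup>2\<close>: the limit is found along an almost surely convergent subsequence, and
  Fatou's lemma upgrades the convergence to mean square.\<close>

lemma mean_square_complete:
  assumes X: "\<And>n. second_order M (X n)"
    and Cauchy: "\<And>e. e > 0 \<Longrightarrow> \<exists>N. \<forall>i\<ge>N. \<forall>j\<ge>N. (LINT \<omega>|M. (X i \<omega> - X j \<omega>)\<^sup>2) < e"
  shows "\<exists>S. second_order M S \<and> (\<lambda>n. LINT \<omega>|M. (X n \<omega> - S \<omega>)\<^sup>2) \<longlonglongrightarrow> 0"
proof -
  note [measurable] = second_order_measurable[OF X]
  \<comment> \<open>The extraction of an almost surely convergent subsequence starts from a Cauchy
    sequence in the first mean, so the second mean is reduced to the first.\<close>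
  have "\<exists>N. \<forall>i\<ge>N. \<forall>j\<ge>N. (LINT \<omega>|M. norm (X i \<omega> - X j \<omega>)) < e" if "e > 0" for e
  proof -
    have L1: "(LINT \<omega>|M. norm (X i \<omega> - X j \<omega>)) < e" if *: "(LINT \<omega>|M. (X i \<omega> - X j \<omega>)\<^sup>2) < e\<^sup>2" for i j
    proof -
      have D: "integrable M (\<lambda>\<omega>. X i \<omega> - X j \<omega>)" "integrable M (\<lambda>\<omega>. (X i \<omega> - X j \<omega>)\<^sup>2)"
        using second_order_diff[OF X X, of i j] second_order_integrable[OF second_order_diff[OF X X], of i j]
        by (simp_all add: second_order_def)
      \<comment> \<open>The inequality of arithmetic and geometric means, weighted by
        \<open>e\<close>: since the total mass is 1, a second moment below \<open>e\<^sup>2\<close>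
        makes the integral of the right side less than \<open>(e + e) / 2\<close>.\<close>
      have "\<bar>x\<bar> \<le> (e + x\<^sup>2 / e) / 2" for x
      proof -
        have "0 \<le> (\<bar>x\<bar> - e)\<^sup>2" by simp
        then show ?thesis using \<open>e > 0\<close>
          unfolding power2_diff by (simp add: field_simps power2_eq_square)
      qed
      then have "(LINT \<omega>|M. norm (X i \<omega> - X j \<omega>)) \<le> (LINT \<omega>|M. (e + (X i \<omega> - X j \<omega>)\<^sup>2 / e) / 2)"
        using D by (intro integral_mono) auto
      also have "\<dots> = (e + (LINT \<omega>|M. (X i \<omega> - X j \<omega>)\<^sup>2) / e) / 2"
        using D by (simp add: prob_space)
      also have "\<dots> < e"
        using * \<open>e > 0\<close> by (simp add: field_simps power2_eq_square)
      finally show ?thesis .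
    qed
    show ?thesis using Cauchy[of "e\<^sup>2"] L1 \<open>e > 0\<close> by (meson zero_less_power)
  qed
  then obtain r where r: "strict_mono r" and C: "AE \<omega> in M. Cauchy (\<lambda>i. X (r i) \<omega>)"
    using cauchy_L1_AE_cauchy_subseq[of M X] second_order_integrable[OF X] by blast
  \<comment> \<open>Where the subsequence diverges, \<open>lim\<close> has an unspecified value;
    this happens only on a null set, and measurability of \<open>S\<close> holds all the
    same.\<close>
  define S where "S \<omega> = lim (\<lambda>i. X (r i) \<omega>)" for \<omega>
  have [measurable]: "S \<in> borel_measurable M"
    unfolding S_def by (rule borel_measurable_lim_metric) measurable
  have conv: "AE \<omega> in M. (\<lambda>i. X (r i) \<omega>) \<longlonglongrightarrow> S \<omega>"
    using C by eventually_elim (simp add: S_def Cauchy_convergent convergent_LIMSEQ_iff[symmetric])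
  \<comment> \<open>Fatou along the subsequence, with \<open>n\<close> fixed. Integrability is part
    of the claim, since the bound alone would be trivially true of a non-integrable function, whose
    integral is 0.\<close>
  have bound: "integrable M (\<lambda>\<omega>. (X n \<omega> - S \<omega>)\<^sup>2) \<and> (LINT \<omega>|M. (X n \<omega> - S \<omega>)\<^sup>2) \<le> e"
    if e: "e \<ge> 0" and N: "\<And>i. i \<ge> N \<Longrightarrow> (LINT \<omega>|M. (X n \<omega> - X i \<omega>)\<^sup>2) \<le> e" for e n N
  proof -
    have "(\<integral>\<^sup>+\<omega>. ennreal ((X n \<omega> - S \<omega>)\<^sup>2) \<partial>M)
        = (\<integral>\<^sup>+\<omega>. liminf (\<lambda>i. ennreal ((X n \<omega> - X (r i) \<omega>)\<^sup>2)) \<partial>M)"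
    proof (rule nn_integral_cong_AE)
      show "AE \<omega> in M. ennreal ((X n \<omega> - S \<omega>)\<^sup>2) = liminf (\<lambda>i. ennreal ((X n \<omega> - X (r i) \<omega>)\<^sup>2))"
        using conv
      proof eventually_elim
        case (elim \<omega>)
        have "(\<lambda>i. ennreal ((X n \<omega> - X (r i) \<omega>)\<^sup>2)) \<longlonglongrightarrow> ennreal ((X n \<omega> - S \<omega>)\<^sup>2)"
          by (intro tendsto_ennrealI tendsto_intros elim)
        then show ?case using lim_imp_Liminf[OF sequentially_bot] by metis
      qed
    qed
    also have "\<dots> \<le> liminf (\<lambda>i. \<integral>\<^sup>+\<omega>. ennreal ((X n \<omega> - X (r i) \<omega>)\<^sup>2) \<partial>M)"
      by (rule nn_integral_liminf) measurable
    also have "\<dots> \<le> liminf (\<lambda>i. ennreal e)"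
    proof (rule Liminf_mono)
      show "\<forall>\<^sub>F i in sequentially. (\<integral>\<^sup>+\<omega>. ennreal ((X n \<omega> - X (r i) \<omega>)\<^sup>2) \<partial>M) \<le> ennreal e"
        using eventually_ge_at_top[of N]
      proof eventually_elim
        case (elim i)
        then have "N \<le> r i" using seq_suble[OF r, of i] by simp
        moreover have "(\<integral>\<^sup>+\<omega>. ennreal ((X n \<omega> - X (r i) \<omega>)\<^sup>2) \<partial>M)
            = ennreal (LINT \<omega>|M. (X n \<omega> - X (r i) \<omega>)\<^sup>2)"
          using second_order_diff[OF X X, of n "r i"]
          by (intro nn_integral_eq_integral) (auto simp: second_order_def)
        ultimately show ?case using N by (simp add: ennreal_leI)
      qed
    qed
    also have "\<dots> = ennreal e" by (simp add: Liminf_const)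
    finally have le: "(\<integral>\<^sup>+\<omega>. ennreal ((X n \<omega> - S \<omega>)\<^sup>2) \<partial>M) \<le> ennreal e" .
    then have int: "integrable M (\<lambda>\<omega>. (X n \<omega> - S \<omega>)\<^sup>2)"
      by (intro integrableI_bounded) (auto intro: le_less_trans)
    then have "ennreal (LINT \<omega>|M. (X n \<omega> - S \<omega>)\<^sup>2) \<le> ennreal e"
      using le by (subst nn_integral_eq_integral[symmetric]) auto
    then show ?thesis using int e by (simp add: ennreal_le_iff)
  qed
  have ev: "\<exists>N. \<forall>n\<ge>N. integrable M (\<lambda>\<omega>. (X n \<omega> - S \<omega>)\<^sup>2) \<and> (LINT \<omega>|M. (X n \<omega> - S \<omega>)\<^sup>2) \<le> e"
    if "e > 0" for e
    using Cauchy[OF that] bound[of e] that by (meson less_imp_le)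
  \<comment> \<open>One index suffices: \<open>S\<close> is the difference of \<open>X n\<close> and
    \<open>X n - S\<close>.\<close>
  obtain n where "integrable M (\<lambda>\<omega>. (X n \<omega> - S \<omega>)\<^sup>2)"
    using ev[of 1] by auto
  then have "second_order M (\<lambda>\<omega>. X n \<omega> - S \<omega>)"
    by (simp add: second_order_def)
  from second_order_diff[OF X this, of n] have "second_order M S" by simp
  moreover have "(\<lambda>n. LINT \<omega>|M. (X n \<omega> - S \<omega>)\<^sup>2) \<longlonglongrightarrow> 0"
  proof (rule LIMSEQ_I)
    fix e :: real assume "e > 0"
    with ev[of "e / 2"] obtain N where "\<forall>n\<ge>N. (LINT \<omega>|M. (X n \<omega> - S \<omega>)\<^sup>2) \<le> e / 2" by auto
    with \<open>e > 0\<close> show "\<exists>N. \<forall>n\<ge>N. norm ((LINT \<omega>|M. (X n \<omega> - S \<omega>)\<^sup>2) - 0) < e"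
      by (intro exI[of _ N]) fastforce
  qed
  ultimately show ?thesis by blast
qed

text \<open>By Pythagoras the squared distance of two partial sums is a block of the convergent
  series of second moments, so the partial sums are Cauchy.\<close>

lemma mean_square_sums_orthogonal:
  assumes X: "\<And>n. second_order M (X n)"
    and orth: "\<And>m n. m \<noteq> n \<Longrightarrow> (LINT \<omega>|M. X m \<omega> * X n \<omega>) = 0"
    and sm: "summable (\<lambda>n. LINT \<omega>|M. (X n \<omega>)\<^sup>2)"
  shows "\<exists>S. mean_square_sums M X S"
proof -
  define P where "P N \<omega> = (\<Sum>n<N. X n \<omega>)" for N \<omega>
  have tail: "(LINT \<omega>|M. (P n \<omega> - P m \<omega>)\<^sup>2) = (\<Sum>k=m..<n. LINT \<omega>|M. (X k \<omega>)\<^sup>2)" if "m \<le> n" for m n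
  proof -
    have "P n \<omega> - P m \<omega> = (\<Sum>k=m..<n. X k \<omega>)" for \<omega>
      using sum_diff_nat_ivl[of 0 m n "\<lambda>k. X k \<omega>"] that by (simp add: P_def lessThan_atLeast0)
    then show ?thesis
      using integral_sum_mult_sum_orthogonal[of "{m..<n}" M X X] X orth
      by (simp add: power2_eq_square)
  qed
  have "\<exists>N. \<forall>i\<ge>N. \<forall>j\<ge>N. (LINT \<omega>|M. (P i \<omega> - P j \<omega>)\<^sup>2) < e" if e: "e > 0" for e
  proof -
    obtain N where N: "\<And>m n. m \<ge> N \<Longrightarrow> norm (\<Sum>k=m..<n. LINT \<omega>|M. (X k \<omega>)\<^sup>2) < e"
      using sm e unfolding summable_Cauchy by blast
    have *: "(LINT \<omega>|M. (P n \<omega> - P m \<omega>)\<^sup>2) < e" if "m \<ge> N" "m \<le> n" for m n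
      using N[OF that(1), of n] tail[OF that(2)] by simp
    have "(LINT \<omega>|M. (P i \<omega> - P j \<omega>)\<^sup>2) < e" if "i \<ge> N" "j \<ge> N" for i j
      using *[of i j] *[of j i] that by (cases "i \<le> j") (auto simp: power2_commute)
    then show ?thesis by blast
  qed
  moreover have "second_order M (P n)" for n
    unfolding P_def by (intro second_order_sum X)
  ultimately show ?thesis
    using mean_square_complete[of P] X unfolding mean_square_sums_def P_def by blast
qed

text \<open>The mean is the inner product with the constant 1, which is square integrable because
  the measure is finite.\<close>

lemma mean_square_sums_mean_zero:
  assumes S: "mean_square_sums M X S" and "\<And>n. mean M (X n) = 0"
  shows "mean M S = 0"
proof -
  have X: "second_order M (X n)" for n using S by (simp add: mean_square_sums_def)
  have "(\<lambda>N. LINT \<omega>|M. (\<Sum>n<N. X n \<omega>) * 1) \<longlonglongrightarrow> (LINT \<omega>|M. S \<omega> * 1)"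
    using S by (intro tendsto_integral_mult)
      (auto simp: mean_square_sums_def second_order_const intro: second_order_sum)
  moreover have "(LINT \<omega>|M. (\<Sum>n<N. X n \<omega>) * 1) = 0" for N
    using second_order_integrable[OF X] assms(2) by (simp add: mean_def)
  ultimately show ?thesis
    by (simp add: mean_def LIMSEQ_const_iff)
qed

text \<open>Parseval's identity in polarized form: the inner products of partial sums reduce to
  their diagonal, and continuity of the inner product passes to the limit.\<close>

lemma mean_square_sums_inner:
  assumes S: "mean_square_sums M X S" and T: "mean_square_sums M Y T"
    and orth: "\<And>m n. m \<noteq> n \<Longrightarrow> (LINT \<omega>|M. X m \<omega> * Y n \<omega>) = 0"
  shows "(\<lambda>n. LINT \<omega>|M. X n \<omega> * Y n \<omega>) sums (LINT \<omega>|M. S \<omega> * T \<omega>)"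
proof -
  have "(\<lambda>N. LINT \<omega>|M. (\<Sum>n<N. X n \<omega>) * (\<Sum>n<N. Y n \<omega>)) \<longlonglongrightarrow> (LINT \<omega>|M. S \<omega> * T \<omega>)"
    using S T by (intro tendsto_integral_mult) (auto simp: mean_square_sums_def intro: second_order_sum)
  moreover have "(LINT \<omega>|M. (\<Sum>n<N. X n \<omega>) * (\<Sum>n<N. Y n \<omega>))
      = (\<Sum>n<N. LINT \<omega>|M. X n \<omega> * Y n \<omega>)" for N
    using S T orth by (intro integral_sum_mult_sum_orthogonal) (auto simp: mean_square_sums_def)
  ultimately show ?thesis by (simp add: sums_def)
qed

text \<open>Evaluation at one latitude is measurable on the path space, so independence of two
  different processes passes to their values, and the mean of the product factorizes.\<close>

lemma independent_processes_uncorrelated: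
  assumes ind: "independent_processes M V"
    and so: "\<And>n j \<phi>. j \<in> {1, 2} \<Longrightarrow> \<phi> \<in> {0..pi} \<Longrightarrow> second_order M (V n j \<phi>)"
    and mz: "\<And>n j \<phi>. j \<in> {1, 2} \<Longrightarrow> \<phi> \<in> {0..pi} \<Longrightarrow> mean M (V n j \<phi>) = 0"
    and ij: "i \<in> {1, 2}" "j \<in> {1, 2}" "(m, i) \<noteq> (n, j)"
    and \<phi>: "\<phi>1 \<in> {0..pi}" "\<phi>2 \<in> {0..pi}"
  shows "(LINT \<omega>|M. V m i \<phi>1 \<omega> * V n j \<phi>2 \<omega>) = 0"
proof -
  let ?W = "\<lambda>(n, j) \<omega>. \<lambda>\<phi>\<in>{0..pi}. V n j \<phi> \<omega>"
  let ?P = "PiM {0..pi} (\<lambda>_. borel :: real measure)"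
  let ?Q = "\<lambda>p. PiM {p :: nat \<times> nat} (\<lambda>_. ?P)"
  \<comment> \<open>Restriction yields independence of subfamilies, so each process appears here as
    a family over a singleton; the evaluations \<open>f p \<phi>\<close> below first select the
    process and then the latitude.\<close>
  have "indep_var (?Q (m, i)) (\<lambda>\<omega>. \<lambda>p\<in>{(m, i)}. ?W p \<omega>) (?Q (n, j)) (\<lambda>\<omega>. \<lambda>p\<in>{(n, j)}. ?W p \<omega>)"
    using ind ij unfolding independent_processes_def by (intro indep_var_restrict) auto
  moreover have "(\<lambda>f. f p \<phi>) \<in> borel_measurable (?Q p)" if "\<phi> \<in> {0..pi}" for p \<phi>
    by (rule measurable_compose[where N = ?P and g = "\<lambda>f. f \<phi>"])
      (use that in \<open>auto intro!: measurable_component_singleton\<close>)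
  ultimately have "indep_var borel ((\<lambda>f. f (m, i) \<phi>1) \<circ> (\<lambda>\<omega>. \<lambda>p\<in>{(m, i)}. ?W p \<omega>))
      borel ((\<lambda>f. f (n, j) \<phi>2) \<circ> (\<lambda>\<omega>. \<lambda>p\<in>{(n, j)}. ?W p \<omega>))"
    using \<phi> by (intro indep_var_compose) auto
  then have "indep_var borel (V m i \<phi>1) borel (V n j \<phi>2)"
    using \<phi> by (simp add: comp_def)
  from indep_var_lebesgue_integral[OF this second_order_integrable[OF so[OF ij(1) \<phi>(1)]]
      second_order_integrable[OF so[OF ij(2) \<phi>(2)]]]
  show ?thesis using mz[OF ij(1) \<phi>(1), of m] by (simp add: mean_def)
qed

end

section \<open>The spectral series\<close>

text \<open>A mean square limit is fixed only up to null sets, hence existence of some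
  \<open>Z\<close> together with the properties of every such \<open>Z\<close>. Summability is
  stated separately because an infinite sum has an unspecified value when the series
  diverges.\<close>

theorem theorem2:
  fixes M :: "'a measure"
    and V :: "nat \<Rightarrow> nat \<Rightarrow> real \<Rightarrow> 'a \<Rightarrow> real"
    and b :: "nat \<Rightarrow> real \<Rightarrow> real \<Rightarrow> real"
  assumes "prob_space M"
    and "\<And>n j \<phi>. j \<in> {1, 2} \<Longrightarrow> \<phi> \<in> {0..pi} \<Longrightarrow> second_order M (V n j \<phi>)"
    and "\<And>n j \<phi>. j \<in> {1, 2} \<Longrightarrow> \<phi> \<in> {0..pi} \<Longrightarrow> mean M (V n j \<phi>) = 0"
    and "\<And>n j \<phi>1 \<phi>2. j \<in> {1, 2} \<Longrightarrow> \<phi>1 \<in> {0..pi} \<Longrightarrow> \<phi>2 \<in> {0..pi} \<Longrightarrow>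
           covariance M (V n j \<phi>1) (V n j \<phi>2) = b n \<phi>1 \<phi>2"
    and "independent_processes M V"
    and "\<And>\<phi>1 \<phi>2. \<phi>1 \<in> {0..pi} \<Longrightarrow> \<phi>2 \<in> {0..pi} \<Longrightarrow> summable (\<lambda>n. b n \<phi>1 \<phi>2)"
  shows "(\<exists>Z. is_spectral_sum M V Z) \<and>
         (\<forall>\<phi>1\<in>{0..pi}. \<forall>\<phi>2\<in>{0..pi}. \<forall>\<theta>\<in>{-2*pi..2*pi}.
            summable (\<lambda>n. b n \<phi>1 \<phi>2 * cos (real n * \<theta>))) \<and>
         (\<forall>Z. is_spectral_sum M V Z \<longrightarrow>
            longitudinally_reversible M Z \<and>
            (\<forall>\<phi>\<in>{0..pi}. \<forall>\<theta>\<in>{0..2*pi}. mean M (Z \<phi> \<theta>) = 0) \<and>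
            has_axial_covariance M Z (\<lambda>\<phi>1 \<phi>2 \<theta>. \<Sum>n. b n \<phi>1 \<phi>2 * cos (real n * \<theta>)))"
proof -

  \<comment> \<open>Moments of the terms, convergence of the covariance series, existence of the
    field\<close>
  interpret prob_space M by fact
  note so = assms(2) and mz = assms(3) and cv = assms(4) and ind = assms(5) and sm = assms(6)
  define X where "X \<phi> \<theta> n \<omega> = V n 1 \<phi> \<omega> * cos (real n * \<theta>) + V n 2 \<phi> \<omega> * sin (real n * \<theta>)"
    for \<phi> \<theta> n \<omega>
  have X_so: "second_order M (X \<phi> \<theta> n)" if "\<phi> \<in> {0..pi}" for \<phi> \<theta> n
    unfolding X_def using that by (intro second_order_add second_order_cmult so) auto
  have X_mean: "mean M (X \<phi> \<theta> n) = 0" if "\<phi> \<in> {0..pi}" for \<phi> \<theta> n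
    using that so[of 1 \<phi> n] so[of 2 \<phi> n] mz[of 1 \<phi> n] mz[of 2 \<phi> n]
    by (simp add: mean_def X_def second_order_integrable)
  have VV: "(LINT \<omega>|M. V n j \<phi>1 \<omega> * V n j \<phi>2 \<omega>) = b n \<phi>1 \<phi>2"
    if "j \<in> {1, 2}" "\<phi>1 \<in> {0..pi}" "\<phi>2 \<in> {0..pi}" for n j \<phi>1 \<phi>2
    using cv[OF that, of n] mz that by (simp add: covariance_def)
  \<comment> \<open>For \<open>m = n\<close> the mixed products vanish by independence, and since
    both processes have the same covariance, the rest combines to the cosine of a
    difference.\<close>
  have XX: "(LINT \<omega>|M. X \<phi>1 \<theta>1 m \<omega> * X \<phi>2 \<theta>2 n \<omega>)
      = (if m = n then b n \<phi>1 \<phi>2 * cos (real n * (\<theta>1 - \<theta>2)) else 0)"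
    if \<phi>: "\<phi>1 \<in> {0..pi}" "\<phi>2 \<in> {0..pi}" for \<phi>1 \<phi>2 \<theta>1 \<theta>2 m n
  proof -
    let ?I = "\<lambda>i j. LINT \<omega>|M. V m i \<phi>1 \<omega> * V n j \<phi>2 \<omega>"
    have int: "integrable M (\<lambda>\<omega>. V m i \<phi>1 \<omega> * V n j \<phi>2 \<omega>)" if "i \<in> {1, 2}" "j \<in> {1, 2}" for i j
      using that \<phi> by (intro second_order_integrable_mult so)
    have "(LINT \<omega>|M. X \<phi>1 \<theta>1 m \<omega> * X \<phi>2 \<theta>2 n \<omega>) = (LINT \<omega>|M.
        (V m 1 \<phi>1 \<omega> * V n 1 \<phi>2 \<omega>) * (cos (real m * \<theta>1) * cos (real n * \<theta>2)) +
        (V m 1 \<phi>1 \<omega> * V n 2 \<phi>2 \<omega>) * (cos (real m * \<theta>1) * sin (real n * \<theta>2)) +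
        (V m 2 \<phi>1 \<omega> * V n 1 \<phi>2 \<omega>) * (sin (real m * \<theta>1) * cos (real n * \<theta>2)) +
        (V m 2 \<phi>1 \<omega> * V n 2 \<phi>2 \<omega>) * (sin (real m * \<theta>1) * sin (real n * \<theta>2)))"
      by (rule Bochner_Integration.integral_cong) (auto simp: X_def algebra_simps)
    also have "\<dots> = ?I 1 1 * (cos (real m * \<theta>1) * cos (real n * \<theta>2)) +
        ?I 1 2 * (cos (real m * \<theta>1) * sin (real n * \<theta>2)) +
        ?I 2 1 * (sin (real m * \<theta>1) * cos (real n * \<theta>2)) +
        ?I 2 2 * (sin (real m * \<theta>1) * sin (real n * \<theta>2))"
      using int by simp
    finally have *: "(LINT \<omega>|M. X \<phi>1 \<theta>1 m \<omega> * X \<phi>2 \<theta>2 n \<omega>) = \<dots>" .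
    \<comment> \<open>The mixed moments vanish even for \<open>m = n\<close>, as the second indices
      differ; the other two need \<open>m \<noteq> n\<close>.\<close>
    have "?I 1 2 = 0" "?I 2 1 = 0" "m \<noteq> n \<Longrightarrow> ?I 1 1 = 0" "m \<noteq> n \<Longrightarrow> ?I 2 2 = 0"
      by (rule independent_processes_uncorrelated[OF ind so mz]; use \<phi> in simp)+
    then show ?thesis
      using * VV[of 1 \<phi>1 \<phi>2 n] VV[of 2 \<phi>1 \<phi>2 n] \<phi>
      by (auto simp: cos_diff algebra_simps)
  qed
  \<comment> \<open>Convergence of the sum of \<open>b n \<phi>1 \<phi>2\<close> might be merely
    conditional and so not survive the cosine factors. Cauchy-Schwarz supplies a majorant from the
    diagonal, where the terms are nonnegative and summable.\<close>
  have b_abs: "\<bar>b n \<phi>1 \<phi>2\<bar> \<le> b n \<phi>1 \<phi>1 + b n \<phi>2 \<phi>2"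
    if \<phi>: "\<phi>1 \<in> {0..pi}" "\<phi>2 \<in> {0..pi}" for n \<phi>1 \<phi>2
  proof -
    have "b n \<phi> \<phi> \<ge> 0" if "\<phi> \<in> {0..pi}" for \<phi>
      unfolding VV[of 1 \<phi> \<phi> n, OF _ that that, symmetric, simplified] by simp
    then have nn: "b n \<phi>1 \<phi>1 \<ge> 0" "b n \<phi>2 \<phi>2 \<ge> 0"
      using \<phi> by auto
    have "(b n \<phi>1 \<phi>2)\<^sup>2 \<le> b n \<phi>1 \<phi>1 * b n \<phi>2 \<phi>2"
      using Cauchy_Schwarz_second_order[OF so so, of 1 \<phi>1 1 \<phi>2 n n] \<phi>
        VV[of 1 \<phi>1 \<phi>1 n] VV[of 1 \<phi>2 \<phi>2 n] VV[of 1 \<phi>1 \<phi>2 n]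
      by (simp add: power2_eq_square)
    also have "\<dots> \<le> (b n \<phi>1 \<phi>1 + b n \<phi>2 \<phi>2)\<^sup>2"
      using nn by (simp add: power2_sum)
    finally show ?thesis using nn by (simp add: abs_le_square_iff[symmetric])
  qed
  have C_summable: "summable (\<lambda>n. b n \<phi>1 \<phi>2 * cos (real n * \<theta>))"
    if \<phi>: "\<phi>1 \<in> {0..pi}" "\<phi>2 \<in> {0..pi}" for \<phi>1 \<phi>2 \<theta>
  proof (rule summable_comparison_test)
    show "summable (\<lambda>n. b n \<phi>1 \<phi>1 + b n \<phi>2 \<phi>2)"
      using sm \<phi> by (intro summable_add) auto
    have "\<bar>b n \<phi>1 \<phi>2\<bar> * \<bar>cos (real n * \<theta>)\<bar> \<le> (b n \<phi>1 \<phi>1 + b n \<phi>2 \<phi>2) * 1" for n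
      using b_abs[OF \<phi>, of n] by (intro mult_mono) auto
    then show "\<exists>N. \<forall>n\<ge>N. norm (b n \<phi>1 \<phi>2 * cos (real n * \<theta>)) \<le> b n \<phi>1 \<phi>1 + b n \<phi>2 \<phi>2"
      by (simp add: abs_mult)
  qed
  have spectral: "is_spectral_sum M V Z \<longleftrightarrow>
      (\<forall>\<phi>\<in>{0..pi}. \<forall>\<theta>\<in>{0..2*pi}. mean_square_sums M (X \<phi> \<theta>) (Z \<phi> \<theta>))" for Z
    by (simp add: is_spectral_sum_def X_def[abs_def])
  have "\<exists>S. mean_square_sums M (X \<phi> \<theta>) S" if "\<phi> \<in> {0..pi}" for \<phi> \<theta>
  proof (rule mean_square_sums_orthogonal)
    show "summable (\<lambda>n. LINT \<omega>|M. (X \<phi> \<theta> n \<omega>)\<^sup>2)"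
      \<comment> \<open>At coinciding points the cosine factor is \<open>cos 0 = 1\<close>, leaving
        the series of \<open>b n \<phi> \<phi>\<close>.\<close>
      using sm[OF that that] XX[OF that that] by (simp add: power2_eq_square)
  qed (use that X_so XX in auto)
  \<comment> \<open>The limits are chosen separately for each pair of coordinates.\<close>
  then have ex: "\<exists>Z. is_spectral_sum M V Z"
    unfolding spectral by metis

  \<comment> \<open>Mean, covariance and reversibility of an arbitrary limit field\<close>
  have main: "longitudinally_reversible M Z"
    "\<forall>\<phi>\<in>{0..pi}. \<forall>\<theta>\<in>{0..2*pi}. mean M (Z \<phi> \<theta>) = 0"
    "has_axial_covariance M Z (\<lambda>\<phi>1 \<phi>2 \<theta>. \<Sum>n. b n \<phi>1 \<phi>2 * cos (real n * \<theta>))"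
    if "is_spectral_sum M V Z" for Z
  proof -
    have Z: "mean_square_sums M (X \<phi> \<theta>) (Z \<phi> \<theta>)" if "\<phi> \<in> {0..pi}" "\<theta> \<in> {0..2*pi}" for \<phi> \<theta>
      using \<open>is_spectral_sum M V Z\<close> that by (simp add: spectral)
    show mean0: "\<forall>\<phi>\<in>{0..pi}. \<forall>\<theta>\<in>{0..2*pi}. mean M (Z \<phi> \<theta>) = 0"
      using mean_square_sums_mean_zero[OF Z X_mean] by blast
    show cov: "has_axial_covariance M Z (\<lambda>\<phi>1 \<phi>2 \<theta>. \<Sum>n. b n \<phi>1 \<phi>2 * cos (real n * \<theta>))"
      unfolding has_axial_covariance_def
    proof (intro ballI)
      fix \<phi>1 \<phi>2 \<theta>1 \<theta>2
      assume \<phi>: "\<phi>1 \<in> {0..pi}" "\<phi>2 \<in> {0..pi}" and \<theta>: "\<theta>1 \<in> {0..2*pi}" "\<theta>2 \<in> {0..2*pi}"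
      have "(\<lambda>n. LINT \<omega>|M. X \<phi>1 \<theta>1 n \<omega> * X \<phi>2 \<theta>2 n \<omega>) sums (LINT \<omega>|M. Z \<phi>1 \<theta>1 \<omega> * Z \<phi>2 \<theta>2 \<omega>)"
        using XX \<phi> \<theta> by (intro mean_square_sums_inner Z) auto
      then have "(\<lambda>n. b n \<phi>1 \<phi>2 * cos (real n * (\<theta>1 - \<theta>2))) sums
          (LINT \<omega>|M. Z \<phi>1 \<theta>1 \<omega> * Z \<phi>2 \<theta>2 \<omega>)"
        using XX \<phi> by simp
      then show "covariance M (Z \<phi>1 \<theta>1) (Z \<phi>2 \<theta>2) = (\<Sum>n. b n \<phi>1 \<phi>2 * cos (real n * (\<theta>1 - \<theta>2)))"
        using mean0 \<phi> \<theta> by (simp add: covariance_def sums_unique)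
    qed
    \<comment> \<open>The terms of the series agree exactly at longitudes 0 and \<open>2*pi\<close>,
      but the two limits may be different versions, so uniqueness gives almost sure
      equality.\<close>
    have "AE \<omega> in M. Z \<phi> 0 \<omega> = Z \<phi> (2*pi) \<omega>" if \<phi>: "\<phi> \<in> {0..pi}" for \<phi>
    proof -
      have "sin (real n * (2 * pi)) = 0" "cos (real n * (2 * pi)) = 1" for n
        using sin_2npi[of n] cos_2npi[of n] by (simp_all add: mult_ac)
      then have "X \<phi> (2*pi) = X \<phi> 0" by (simp add: X_def fun_eq_iff)
      then show ?thesis
        using Z[OF \<phi>, of 0] Z[OF \<phi>, of "2*pi"]
        by (intro mean_square_limit_unique[of M "\<lambda>N \<omega>. \<Sum>n<N. X \<phi> 0 n \<omega>"])
          (auto simp: mean_square_sums_def intro: second_order_sum)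
    qed
    then have "second_order_field M Z"
      using Z by (auto simp: second_order_field_def mean_square_sums_def)
    \<comment> \<open>The witnesses are the zero mean and the cosine series; the latter is
      reversible because the cosine is even.\<close>
    then show "longitudinally_reversible M Z"
      unfolding longitudinally_reversible_def axially_symmetric_def
      using mean0 cov by (auto simp: reversible_covariance_def
          intro!: exI[of _ "\<lambda>_. 0"] exI[of _ "\<lambda>\<phi>1 \<phi>2 \<theta>. \<Sum>n. b n \<phi>1 \<phi>2 * cos (real n * \<theta>)"])
  qed
  show ?thesis using ex C_summable main by simp
qed

end
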